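(* Let $n\ge2$ and let $A=[a_{ij}]\in M_n$ be a strictly diagonally dominant nonsingular $M$-matrix. For $t=1,2,\ldots$ put $$\widetilde{\Gamma}_t=\frac{2}{\max\limits_{i\neq j}\Big\{\phi_i^{(t)}+\phi_j^{(t)}+\Big[(\phi_{ij}^{(t)})^2+4\phi_{i}^{(t)}\phi_{j}^{(t)}\Big(\sum\limits_{k\neq i}p_{ki}^{(t)}\Big)\Big(\sum\limits_{k\neq j}p_{kj}^{(t)}\Big)\Big]^{\frac12}\Big\}},\qquad \widetilde{\Omega}_t=\frac{1}{\max\limits_{i\in N}\Big\{\Big(1+\sum\limits_{k\neq i}p_{ki}^{(t)}\Big)\phi_i^{(t)}\Big\}},$$ where $$\phi_{ij}^{(t)}=\max\{\phi_i^{(t)},\phi_j^{(t)}\}-\min\left\{\frac{1}{a_{ii}-\sum\limits_{k\neq i}\frac{a_{ik}a_{ki}}{a_{kk}}},\ \frac{1}{a_{jj}-\sum\limits_{k\neq j}\frac{a_{jk}a_{kj}}{a_{kk}}}\right\}.$$ Then each of the sequences $\{\widetilde{\Gamma}_t\}_{t\ge1}$ and $\{\widetilde{\Omega}_t\}_{t\ge1}$ is monotone increasing (in the non-strict sense) with upper bound $\tau(A)$ and, consequently, is convergent.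
   Context: Let $N=\{1,\ldots,n\}$, $n\ge2$. All indices range over $N$. A matrix is called nonnegative ($\ge 0$) if all its entries are nonnegative. A matrix $A=[a_{ij}]\in\mathbb{R}^{n\times n}$ is a nonsingular $M$-matrix if $a_{ij}\le 0$ for all $i\ne j$ and $A$ is invertible with $A^{-1}\ge 0$; $M_n$ denotes the set of all $n\times n$ nonsingular $M$-matrices. For $A\in M_n$, $\tau(A)=\rho(A^{-1})^{-1}$, where $\rho$ denotes the spectral radius (the minimum eigenvalue of $A$; equivalently $\tau(A)=\min\{|\lambda|:\lambda\in\sigma(A)\}$). $A$ is strictly diagonally dominant if $\sum_{j\ne i}|a_{ij}|<|a_{ii}|$ for all $i\in N$. For $A=[a_{ij}]$ with $a_{ii}\ne0$, for $i,j\in N$, $j\ne i$, and $t=1,2,\ldots$, define $$r_i=\max_{j\neq i}\frac{|a_{ji}|}{|a_{jj}|-\sum_{k\ne j,i}|a_{jk}|},\qquad m_{ji}=\frac{|a_{ji}|+\sum_{k\ne j,i}|a_{jk}|r_i}{|a_{jj}|},$$ $$h_i=\max_{j\ne i}\frac{|a_{ji}|}{|a_{jj}|m_{ji}-\sum_{k\ne j,i}|a_{jk}|m_{ki}},\qquad u_{ji}=\frac{|a_{ji}|+\sum_{k\ne j,i}|a_{jk}|m_{ki}h_i}{|a_{jj}|},\qquad u^{(0)}_{ji}=u_{ji},$$ and recursively $$p^{(t)}_{ji}=\frac{|a_{ji}|+\sum_{k\ne j,i}|a_{jk}|u^{(t-1)}_{ki}}{|a_{jj}|},\qquad h^{(t)}_i=\max_{j\ne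 i}\frac{|a_{ji}|}{|a_{jj}|p^{(t)}_{ji}-\sum_{k\ne j,i}|a_{jk}|p^{(t)}_{ki}},\qquad u^{(t)}_{ji}=\frac{|a_{ji}|+\sum_{k\ne j,i}|a_{jk}|p^{(t)}_{ki}h^{(t)}_i}{|a_{jj}|}.$$ Finally, $$\phi_i^{(t)}=\frac{1}{a_{ii}-\sum_{j\ne i}|a_{ij}|p^{(t)}_{ji}}.$$ *)

theory Defs
  imports
    "HOL-Analysis.Analysis"
    "Jordan_Normal_Form.Gauss_Jordan_Elimination"
    "Jordan_Normal_Form.Spectral_Radius"
begin

text \<open>Rows and columns of an \<open>n\<close> by \<open>n\<close> matrix are indexed by \<open>0, ..., n - 1\<close> instead of
  \<open>1, ..., n\<close>.\<close>

definition inverse_mat :: "real mat \<Rightarrow> real mat" where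
  "inverse_mat A = the (mat_inverse A)"

lemma inverse_mat:
  assumes A: "A \<in> carrier_mat n n" and inv: "invertible_mat A"
  shows "inverse_mat A \<in> carrier_mat n n"
    and "A * inverse_mat A = 1\<^sub>m n"
    and "inverse_mat A * A = 1\<^sub>m n"
proof -
  obtain B where B: "A * B = 1\<^sub>m n" "B * A = 1\<^sub>m (dim_row B)"
    using A inv unfolding invertible_mat_def inverts_mat_def by auto
  have "dim_col B = n" "dim_row B = n"
    using arg_cong[OF B(1), of dim_col] arg_cong[OF B(2), of dim_col] A by auto
  then have "A \<in> Units (ring_mat TYPE(real) n ())"
    using A B unfolding Units_def ring_mat_def by auto
  then obtain C where C: "mat_inverse A = Some C"
    using mat_inverse(1)[OF A, where b = "()"] by (cases "mat_inverse A") auto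
  show "inverse_mat A \<in> carrier_mat n n" "A * inverse_mat A = 1\<^sub>m n"
    "inverse_mat A * A = 1\<^sub>m n"
    using mat_inverse(2)[OF A C] C unfolding inverse_mat_def by auto
qed

definition M_matrices :: "nat \<Rightarrow> real mat set" where
  "M_matrices n = {A \<in> carrier_mat n n.
     (\<forall>i<n. \<forall>j<n. i \<noteq> j \<longrightarrow> A $$ (i,j) \<le> 0) \<and>
     invertible_mat A \<and> 0\<^sub>m n n \<le> inverse_mat A}"

definition tau :: "real mat \<Rightarrow> real" where
  "tau A = inverse (spectral_radius (map_mat complex_of_real (inverse_mat A)))"

definition strictly_diag_dominant :: "real mat \<Rightarrow> bool" where
  "strictly_diag_dominant A \<longleftrightarrow>
     (\<forall>i<dim_row A. (\<Sum>j\<in>{..<dim_row A} - {i}. \<bar>A $$ (i,j)\<bar>) < \<bar>A $$ (i,i)\<bar>)"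

definition r_coeff :: "real mat \<Rightarrow> nat \<Rightarrow> real" where
  "r_coeff A i = Max ((\<lambda>j. \<bar>A $$ (j,i)\<bar> /
      (\<bar>A $$ (j,j)\<bar> - (\<Sum>k\<in>{..<dim_row A} - {j,i}. \<bar>A $$ (j,k)\<bar>)))
    ` ({..<dim_row A} - {i}))"

definition m_coeff :: "real mat \<Rightarrow> nat \<Rightarrow> nat \<Rightarrow> real" where
  "m_coeff A j i =
     (\<bar>A $$ (j,i)\<bar> + (\<Sum>k\<in>{..<dim_row A} - {j,i}. \<bar>A $$ (j,k)\<bar> * r_coeff A i)) / \<bar>A $$ (j,j)\<bar>"

text \<open>\<open>h_i\<close> and \<open>u_ji\<close> are obtained from the array \<open>q = m\<close> by the same formulas by which \<open>h_i^(t)\<close>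
  and \<open>u_ji^(t)\<close> are obtained from \<open>q = p^(t)\<close>, whence the array argument \<open>q\<close> below.

  For strictly diagonally dominant \<open>A\<close> the denominator in \<open>h_from\<close> is at least
  \<open>|a_ji|\<close> for these \<open>q\<close>, so it can only vanish together with the numerator; such a term
  then counts as \<open>0/0 = 0\<close>.\<close>

definition h_from :: "real mat \<Rightarrow> (nat \<Rightarrow> nat \<Rightarrow> real) \<Rightarrow> nat \<Rightarrow> real" where
  "h_from A q i = Max ((\<lambda>j. \<bar>A $$ (j,i)\<bar> /
      (\<bar>A $$ (j,j)\<bar> * q j i - (\<Sum>k\<in>{..<dim_row A} - {j,i}. \<bar>A $$ (j,k)\<bar> * q k i)))
    ` ({..<dim_row A} - {i}))"

definition u_from :: "real mat \<Rightarrow> (nat \<Rightarrow> nat \<Rightarrow> real) \<Rightarrow> nat \<Rightarrow> nat \<Rightarrow> real" where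
  "u_from A q j i =
     (\<bar>A $$ (j,i)\<bar> + (\<Sum>k\<in>{..<dim_row A} - {j,i}. \<bar>A $$ (j,k)\<bar> * q k i * h_from A q i))
       / \<bar>A $$ (j,j)\<bar>"

definition p_from :: "real mat \<Rightarrow> (nat \<Rightarrow> nat \<Rightarrow> real) \<Rightarrow> nat \<Rightarrow> nat \<Rightarrow> real" where
  "p_from A u j i =
     (\<bar>A $$ (j,i)\<bar> + (\<Sum>k\<in>{..<dim_row A} - {j,i}. \<bar>A $$ (j,k)\<bar> * u k i)) / \<bar>A $$ (j,j)\<bar>"

primrec u_seq :: "real mat \<Rightarrow> nat \<Rightarrow> nat \<Rightarrow> nat \<Rightarrow> real" where
  "u_seq A 0 = u_from A (m_coeff A)"
| "u_seq A (Suc t) = u_from A (p_from A (u_seq A t))"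

text \<open>From here on, only the values at \<open>t \<ge> 1\<close> are meaningful.\<close>

definition p_seq :: "real mat \<Rightarrow> nat \<Rightarrow> nat \<Rightarrow> nat \<Rightarrow> real" where
  "p_seq A t = p_from A (u_seq A (t - 1))"

definition phi :: "real mat \<Rightarrow> nat \<Rightarrow> nat \<Rightarrow> real" where
  "phi A t i =
     1 / (A $$ (i,i) - (\<Sum>j\<in>{..<dim_row A} - {i}. \<bar>A $$ (i,j)\<bar> * p_seq A t j i))"

definition diag_lower :: "real mat \<Rightarrow> nat \<Rightarrow> real" where
  "diag_lower A i =
     1 / (A $$ (i,i) - (\<Sum>k\<in>{..<dim_row A} - {i}. A $$ (i,k) * A $$ (k,i) / A $$ (k,k)))"

definition phi2 :: "real mat \<Rightarrow> nat \<Rightarrow> nat \<Rightarrow> nat \<Rightarrow> real" where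
  "phi2 A t i j = max (phi A t i) (phi A t j) - min (diag_lower A i) (diag_lower A j)"

definition p_sum :: "real mat \<Rightarrow> nat \<Rightarrow> nat \<Rightarrow> real" where
  "p_sum A t i = (\<Sum>k\<in>{..<dim_row A} - {i}. p_seq A t k i)"

definition Gamma_seq :: "real mat \<Rightarrow> nat \<Rightarrow> real" where
  "Gamma_seq A t = 2 / Max {phi A t i + phi A t j
       + sqrt ((phi2 A t i j)\<^sup>2 + 4 * phi A t i * phi A t j * p_sum A t i * p_sum A t j)
     | i j. i < dim_row A \<and> j < dim_row A \<and> i \<noteq> j}"

definition Omega_seq :: "real mat \<Rightarrow> nat \<Rightarrow> real" where
  "Omega_seq A t = 1 / Max ((\<lambda>i. (1 + p_sum A t i) * phi A t i) ` {..<dim_row A})"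

end

theory Submission
  imports Defs
begin

text \<open>Write \<open>B = A\<^bsup>-1\<^esup>\<close>, so that \<open>1 / tau A\<close> is the spectral radius of the nonnegative matrix \<open>B\<close>. For a
  fixed column \<open>i\<close> the ratios \<open>x\<^sub>j = b\<^sub>j\<^sub>i / b\<^sub>i\<^sub>i\<close> with \<open>j \<noteq> i\<close> solve
  \<open>a\<^sub>j\<^sub>j x\<^sub>j = |a\<^sub>j\<^sub>i| + \<Sum>\<^sub>k |a\<^sub>j\<^sub>k| x\<^sub>k\<close>, where \<open>k\<close> runs over the indices other than \<open>j\<close> and \<open>i\<close>;
  that is, they form a fixed point of the monotone operator \<open>p_from A\<close>. All arrays \<open>m\<close>, \<open>u\<close> and
  \<open>p\<close> of the recursion are supersolutions of this fixed-point problem. The constant \<open>r\<^sub>i\<close> is one by its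
  definition, being the least constant that qualifies. Applying the operator to a supersolution gives
  a supersolution that is nowhere larger, and so does multiplication by \<open>h\<^sub>i \<le> 1\<close>, which is the least
  nonnegative factor that preserves the property (\<open>rescaled_supersolution\<close>). As every step of the
  recursion is one of these two operations, the iterates \<open>p\<^bsup>(t)\<^esup>\<close> decrease with \<open>t\<close>; and
  as strict diagonal dominance yields a comparison principle
  (\<open>inverse_le_supersolution\<close>), they stay above \<open>x\<close>. Hence \<open>b\<^sub>j\<^sub>i \<le> p\<^sub>j\<^sub>i b\<^sub>i\<^sub>i\<close>.

  The diagonal entries are squeezed by inserting bounds for \<open>x\<close> into row \<open>i\<close> of \<open>A B = I\<close>:
  \<open>x\<^sub>j \<le> p\<^sub>j\<^sub>i\<close> gives \<open>b\<^sub>i\<^sub>i \<le> \<phi>\<^sub>i\<close>, while \<open>x\<^sub>j \<ge> |a\<^sub>j\<^sub>i| / a\<^sub>j\<^sub>j\<close> gives the lower bound \<open>diag_lower\<close>. The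
  quantities \<open>\<phi>\<^sub>i\<close>, \<open>phi2\<close> and the column sums of \<open>p\<close> are all nonnegative and decrease with \<open>t\<close>, so the
  maxima in the denominators of both sequences decrease, and the sequences increase.

  The upper bound \<open>tau A\<close> comes from eigenvalue localisation for \<open>B\<close> by columns: the
  Gershgorin bound, a column sum of \<open>B\<close>, gives the bound for \<open>Omega_seq\<close>; the Brauer bound by ovals
  of Cassini gives the one for \<open>Gamma_seq\<close>, where the difference of two diagonal entries of \<open>B\<close> is
  at most \<open>phi2\<close> by the squeeze above.\<close>

section \<open>Reciprocal maxima and bounded increasing sequences\<close>

lemma inverse_Max_le:
  fixes f :: "'a \<Rightarrow> real"
  assumes "finite S" "a \<in> S" "x \<le> f a" "0 < x"
  shows "1 / Max (f ` S) \<le> 1 / x"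
proof -
  have "x \<le> Max (f ` S)" using assms by (meson Max_ge finite_imageI imageI order_trans)
  then show ?thesis using assms by (simp add: frac_le)
qed

lemma inverse_Max_mono:
  fixes f g :: "'a \<Rightarrow> real"
  assumes S: "finite S" "S \<noteq> {}" and le: "\<And>a. a \<in> S \<Longrightarrow> g a \<le> f a"
    and pos: "\<And>a. a \<in> S \<Longrightarrow> 0 < g a"
  shows "1 / Max (f ` S) \<le> 1 / Max (g ` S)"
proof -
  have "Max (g ` S) \<in> g ` S" using S by (intro Max_in) auto
  then obtain a where "a \<in> S" "Max (g ` S) = g a" by auto
  then show ?thesis using inverse_Max_le[of S a "g a" f] S le pos by simp
qed

lemma increasing_bounded_convergent:
  fixes f :: "nat \<Rightarrow> real"
  assumes step: "\<And>t. f t \<le> f (Suc t)" and bound: "\<And>t. f t \<le> b"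
  shows "mono_on S f" "convergent f"
proof -
  have f: "incseq f" by (intro incseq_SucI step)
  then show "mono_on S f" by (auto intro!: mono_onI dest: incseqD)
  show "convergent f" using incseq_convergent[OF f] bound by (metis convergent_def)
qed

section \<open>Column bounds for the spectral radius of a nonnegative matrix\<close>

text \<open>Take an eigenvalue of maximal modulus, an eigenvector of the transpose for it, and the moduli of
  its entries. Keeping only this inequality makes the two localisation bounds below statements about
  real numbers, and it replaces the Perron--Frobenius theorem: the spectral radius need not be
  known to be an eigenvalue.\<close>

lemma nonneg_mat_subeigenvector:
  fixes B :: "real mat"
  assumes B: "B \<in> carrier_mat n n" and "n > 0"
    and nonneg: "\<And>i j. i < n \<Longrightarrow> j < n \<Longrightarrow> 0 \<le> B $$ (i,j)"
  obtains w :: "nat \<Rightarrow> real" where "\<And>i. 0 \<le> w i" "\<exists>i<n. 0 < w i"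
    "\<And>i. i < n \<Longrightarrow> spectral_radius (map_mat complex_of_real B) * w i \<le> (\<Sum>k<n. B $$ (k,i) * w k)"
proof -
  define C where "C = map_mat complex_of_real B"
  have C: "C \<in> carrier_mat n n" using B by (simp add: C_def)
  obtain l where l: "eigenvalue C l" and norm_l: "spectral_radius C = norm l"
    using spectral_radius_mem_max(1)[OF C] \<open>n > 0\<close> by (auto simp: spectrum_def)
  have "eigenvalue C\<^sup>T l"
    using l C eigenvalue_root_char_poly[OF C] eigenvalue_root_char_poly[of "C\<^sup>T" n]
    by simp
  then obtain v where v: "v \<in> carrier_vec n" "v \<noteq> 0\<^sub>v n" and Cv: "C\<^sup>T *\<^sub>v v = l \<cdot>\<^sub>v v"
    using C by (auto simp: eigenvalue_def eigenvector_def)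
  define w where "w i = norm (v $ i)" for i
  have "\<exists>i<n. v $ i \<noteq> 0" using v by (metis carrier_vecD eq_vecI index_zero_vec)
  then have pos: "\<exists>i<n. 0 < w i" by (auto simp: w_def)
  have le: "spectral_radius C * w i \<le> (\<Sum>k<n. B $$ (k,i) * w k)" if i: "i < n" for i
  proof -
    have "l * v $ i = (C\<^sup>T *\<^sub>v v) $ i" using Cv v i by simp
    also have "\<dots> = (\<Sum>k<n. complex_of_real (B $$ (k,i)) * v $ k)"
      using B C v i by (auto simp: scalar_prod_def C_def atLeast0LessThan intro!: sum.cong)
    finally have "spectral_radius C * w i = norm (\<Sum>k<n. complex_of_real (B $$ (k,i)) * v $ k)"
      by (simp add: norm_l w_def flip: norm_mult)
    also have "\<dots> \<le> (\<Sum>k<n. norm (complex_of_real (B $$ (k,i)) * v $ k))" by (rule norm_sum)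
    also have "\<dots> = (\<Sum>k<n. B $$ (k,i) * w k)"
      using i nonneg by (intro sum.cong) (auto simp: norm_mult w_def)
    finally show ?thesis .
  qed
  show thesis using that[of w] pos le by (simp add: w_def C_def)
qed

lemma other_index_exists:
  assumes "n \<ge> 2" shows "{..<n} - {i::nat} \<noteq> {}"
proof -
  have "(if i = 0 then 1 else 0) \<in> {..<n} - {i}" using assms by auto
  then show ?thesis by blast
qed

lemma two_largest:
  fixes w :: "nat \<Rightarrow> real"
  assumes "n \<ge> 2"
  obtains i j where "i < n" "j < n" "i \<noteq> j" "\<And>k. k < n \<Longrightarrow> w k \<le> w i"
    "\<And>k. k < n \<Longrightarrow> k \<noteq> i \<Longrightarrow> w k \<le> w j"
proof -
  have ex: "\<exists>i\<in>S. \<forall>k\<in>S. w k \<le> w i" if "finite S" "S \<noteq> {}" for S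
    using Max_in[of "w ` S"] Max_ge[of "w ` S"] that by fastforce
  obtain i where i: "i < n" "\<And>k. k < n \<Longrightarrow> w k \<le> w i"
    using ex[of "{..<n}"] assms by fastforce
  obtain j where j: "j < n" "i \<noteq> j" "\<And>k. k < n \<Longrightarrow> k \<noteq> i \<Longrightarrow> w k \<le> w j"
    using ex[of "{..<n} - {i}"] other_index_exists[OF assms, of i] by fastforce
  show thesis by (rule that[OF i(1) j(1,2) i(2) j(3)])
qed

text \<open>Gershgorin's argument, at an index where the subeigenvector is largest.\<close>

lemma spectral_radius_le_column_sum:
  fixes B :: "real mat"
  assumes B: "B \<in> carrier_mat n n" and n: "n \<ge> 2"
    and nonneg: "\<And>i j. i < n \<Longrightarrow> j < n \<Longrightarrow> 0 \<le> B $$ (i,j)"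
  obtains i where "i < n" "spectral_radius (map_mat complex_of_real B) \<le> (\<Sum>k<n. B $$ (k,i))"
proof -
  let ?rho = "spectral_radius (map_mat complex_of_real B)"
  obtain w where w: "\<And>i. 0 \<le> w i" "\<exists>i<n. 0 < w i"
    "\<And>i. i < n \<Longrightarrow> ?rho * w i \<le> (\<Sum>k<n. B $$ (k,i) * w k)"
    using nonneg_mat_subeigenvector[OF B _ nonneg] n by auto
  obtain i j where i: "i < n" "\<And>k. k < n \<Longrightarrow> w k \<le> w i" using two_largest[OF n] by metis
  have "?rho * w i \<le> (\<Sum>k<n. B $$ (k,i) * w k)" using w(3) i(1) by simp
  also have "\<dots> \<le> (\<Sum>k<n. B $$ (k,i) * w i)"
    using i nonneg by (intro sum_mono mult_left_mono) auto
  finally have "?rho * w i \<le> (\<Sum>k<n. B $$ (k,i)) * w i" by (simp add: sum_distrib_right)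
  moreover have "0 < w i" using w(2) i by (meson order_less_le_trans)
  ultimately show thesis using that[of i] i(1) by simp
qed

text \<open>The right-hand side is twice the larger eigenvalue of the matrix with rows \<open>(b1, c1)\<close> and
  \<open>(c2, b2)\<close>. If \<open>l\<close> exceeds both diagonal entries, multiplying the two hypotheses gives
  \<open>(l - b1) (l - b2) \<le> c1 c2\<close>; otherwise
  \<open>2 l \<le> b1 + b2 + |b1 - b2|\<close>, and the square root is at least \<open>|b1 - b2|\<close>.\<close>

lemma two_by_two_root_bound:
  fixes l :: real
  assumes v: "l * v1 \<le> b1 * v1 + c1 * v2" and w: "l * v2 \<le> b2 * v2 + c2 * v1"
    and pos: "0 < v1" "0 \<le> v2" and c: "0 \<le> c1" "0 \<le> c2"
  shows "2 * l \<le> b1 + b2 + sqrt ((b1 - b2)\<^sup>2 + 4 * (c1 * c2))"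
proof (cases "l \<le> max b1 b2")
  case True
  have "\<bar>b1 - b2\<bar> \<le> sqrt ((b1 - b2)\<^sup>2 + 4 * (c1 * c2))"
    using c by (intro real_le_rsqrt) (simp add: power2_abs)
  then show ?thesis using True by linarith
next
  case False
  have "(l - b1) * v1 \<le> c1 * v2" "(l - b2) * v2 \<le> c2 * v1"
    using v w by (simp_all add: algebra_simps)
  moreover have "v2 > 0"
  proof (rule ccontr)
    assume "\<not> v2 > 0"
    then have "(l - b1) * v1 \<le> 0" using \<open>(l - b1) * v1 \<le> c1 * v2\<close> pos(2) by simp
    moreover have "0 < (l - b1) * v1" using False pos(1) by (intro mult_pos_pos) auto
    ultimately show False by simp
  qed
  ultimately have "((l - b1) * v1) * ((l - b2) * v2) \<le> (c1 * v2) * (c2 * v1)"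
    using False pos c by (intro mult_mono[of "(l - b1) * v1" "c1 * v2"]) auto
  then have "((l - b1) * (l - b2)) * (v1 * v2) \<le> (c1 * c2) * (v1 * v2)"
    by (simp add: mult_ac)
  then have "(l - b1) * (l - b2) \<le> c1 * c2"
    using pos(1) \<open>v2 > 0\<close> by simp
  moreover have "(2 * l - b1 - b2)\<^sup>2 = (b1 - b2)\<^sup>2 + 4 * ((l - b1) * (l - b2))"
    by (simp add: power2_eq_square algebra_simps)
  ultimately have "2 * l - b1 - b2 \<le> sqrt ((b1 - b2)\<^sup>2 + 4 * (c1 * c2))"
    by (intro real_le_rsqrt) simp
  then show ?thesis by simp
qed

text \<open>Brauer's argument: compare the inequalities of the subeigenvector at its largest and its second
  largest entry, which reduces the bound to the two-dimensional case.\<close>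

lemma spectral_radius_le_Brauer:
  fixes B :: "real mat"
  assumes B: "B \<in> carrier_mat n n" and n: "n \<ge> 2"
    and nonneg: "\<And>i j. i < n \<Longrightarrow> j < n \<Longrightarrow> 0 \<le> B $$ (i,j)"
  obtains i j where "i < n" "j < n" "i \<noteq> j"
    "2 * spectral_radius (map_mat complex_of_real B) \<le> B $$ (i,i) + B $$ (j,j)
      + sqrt ((B $$ (i,i) - B $$ (j,j))\<^sup>2
          + 4 * ((\<Sum>k\<in>{..<n} - {i}. B $$ (k,i)) * (\<Sum>k\<in>{..<n} - {j}. B $$ (k,j))))"
proof -
  let ?rho = "spectral_radius (map_mat complex_of_real B)"
  let ?c = "\<lambda>i. \<Sum>k\<in>{..<n} - {i}. B $$ (k,i)"
  obtain w where w: "\<And>i. 0 \<le> w i" "\<exists>i<n. 0 < w i"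
    "\<And>i. i < n \<Longrightarrow> ?rho * w i \<le> (\<Sum>k<n. B $$ (k,i) * w k)"
    using nonneg_mat_subeigenvector[OF B _ nonneg] n by auto
  obtain i j where ij: "i < n" "j < n" "i \<noteq> j"
    and i: "\<And>k. k < n \<Longrightarrow> w k \<le> w i" and j: "\<And>k. k < n \<Longrightarrow> k \<noteq> i \<Longrightarrow> w k \<le> w j"
    using two_largest[OF n] by metis
  have *: "?rho * w a \<le> B $$ (a,a) * w a + ?c a * w b"
    if "a < n" and b: "\<And>k. k < n \<Longrightarrow> k \<noteq> a \<Longrightarrow> w k \<le> w b" for a b
  proof -
    have "(\<Sum>k<n. B $$ (k,a) * w k)
        = B $$ (a,a) * w a + (\<Sum>k\<in>{..<n} - {a}. B $$ (k,a) * w k)"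
      using \<open>a < n\<close> by (simp add: sum.remove[of _ a])
    also have "(\<Sum>k\<in>{..<n} - {a}. B $$ (k,a) * w k) \<le> (\<Sum>k\<in>{..<n} - {a}. B $$ (k,a) * w b)"
      using b nonneg \<open>a < n\<close> by (intro sum_mono mult_left_mono) auto
    finally show ?thesis using w(3)[OF \<open>a < n\<close>] by (simp add: sum_distrib_right)
  qed
  have "0 < w i" using w(2) i by (meson order_less_le_trans)
  moreover have "0 \<le> ?c a" if "a < n" for a using nonneg that by (intro sum_nonneg) auto
  ultimately show thesis
    using that[OF ij two_by_two_root_bound[OF *[OF ij(1) j] *[OF ij(2) i]]] w(1) ij by simp
qed

section \<open>Supersolutions of the off-diagonal column equations\<close>

text \<open>Only off-diagonal entries are constrained, since the diagonal of \<open>q\<close> is never read. The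
  columns \<open>i\<close> are independent fixed-point problems, treated together so that whole arrays of the
  recursion can be compared.\<close>

definition supersolution :: "real mat \<Rightarrow> (nat \<Rightarrow> nat \<Rightarrow> real) \<Rightarrow> bool" where
  "supersolution A q \<longleftrightarrow>
     (\<forall>i<dim_row A. \<forall>j<dim_row A. j \<noteq> i \<longrightarrow> 0 \<le> q j i \<and> p_from A q j i \<le> q j i)"

definition offdiag_le :: "real mat \<Rightarrow> (nat \<Rightarrow> nat \<Rightarrow> real) \<Rightarrow> (nat \<Rightarrow> nat \<Rightarrow> real) \<Rightarrow> bool" where
  "offdiag_le A q q' \<longleftrightarrow> (\<forall>i<dim_row A. \<forall>j<dim_row A. j \<noteq> i \<longrightarrow> q j i \<le> q' j i)"

lemma offdiag_le_trans: "offdiag_le A q q' \<Longrightarrow> offdiag_le A q' q'' \<Longrightarrow> offdiag_le A q q''"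
  unfolding offdiag_le_def by (meson order_trans)

lemma offdiag_le_p_from: "supersolution A q \<Longrightarrow> offdiag_le A (p_from A q) q"
  unfolding supersolution_def offdiag_le_def by simp

lemma m_coeff_eq_p_from: "m_coeff A = p_from A (\<lambda>_. r_coeff A)"
  by (intro ext) (simp add: m_coeff_def p_from_def)

text \<open>This is what reduces the recursion to two operations: rescaling by \<open>h\<close> and applying
  \<open>p_from A\<close>.\<close>

lemma u_from_eq_p_from: "u_from A q = p_from A (\<lambda>j i. h_from A q i * q j i)"
  by (intro ext) (simp add: u_from_def p_from_def mult_ac)

lemma p_seq_Suc: "p_seq A (Suc t) = p_from A (u_seq A t)"
  by (simp add: p_seq_def)

locale diag_dominant_M_matrix =
  fixes A :: "real mat" and n :: nat
  assumes n: "n \<ge> 2"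
    and M_matrix: "A \<in> M_matrices n"
    and dominant: "strictly_diag_dominant A"
begin

abbreviation "B \<equiv> inverse_mat A"

lemma A_carrier: "A \<in> carrier_mat n n"
  using M_matrix by (simp add: M_matrices_def)

lemma dim_A [simp]: "dim_row A = n" "dim_col A = n"
  using A_carrier by auto

lemma offdiag_abs: "i < n \<Longrightarrow> j < n \<Longrightarrow> i \<noteq> j \<Longrightarrow> A $$ (i,j) = - \<bar>A $$ (i,j)\<bar>"
  using M_matrix by (auto simp: M_matrices_def)

lemma inverse_carrier: "B \<in> carrier_mat n n"
  and mult_inverse: "A * B = 1\<^sub>m n"
  using M_matrix inverse_mat[of A n] by (auto simp: M_matrices_def)

lemma inverse_nonneg: "i < n \<Longrightarrow> j < n \<Longrightarrow> 0 \<le> B $$ (i,j)"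
  using M_matrix by (auto simp: M_matrices_def less_eq_mat_def)

lemma row_times_inverse:
  assumes "i < n" "j < n"
  shows "A $$ (j,j) * B $$ (j,i) - (\<Sum>k\<in>{..<n} - {j}. \<bar>A $$ (j,k)\<bar> * B $$ (k,i))
    = (if i = j then 1 else 0)"
proof -
  have "(A * B) $$ (j,i) = (\<Sum>k<n. A $$ (j,k) * B $$ (k,i))"
    using assms inverse_carrier by (auto simp: scalar_prod_def atLeast0LessThan intro!: sum.cong)
  also have "\<dots> = A $$ (j,j) * B $$ (j,i) + (\<Sum>k\<in>{..<n} - {j}. A $$ (j,k) * B $$ (k,i))"
    using assms by (simp add: sum.remove[of _ j])
  also have "(\<Sum>k\<in>{..<n} - {j}. A $$ (j,k) * B $$ (k,i))
      = - (\<Sum>k\<in>{..<n} - {j}. \<bar>A $$ (j,k)\<bar> * B $$ (k,i))"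
    unfolding sum_negf[symmetric]
    using assms(2) by (intro sum.cong refl) (subst offdiag_abs, auto)
  finally show ?thesis using assms by (auto simp: mult_inverse)
qed

lemma diag_pos:
  assumes "i < n" shows "0 < A $$ (i,i)" "0 < B $$ (i,i)"
proof -
  have "0 \<le> (\<Sum>k\<in>{..<n} - {i}. \<bar>A $$ (i,k)\<bar> * B $$ (k,i))"
    using inverse_nonneg assms by (intro sum_nonneg) auto
  then have "0 < A $$ (i,i) * B $$ (i,i)"
    using row_times_inverse[OF assms assms] by simp
  then show "0 < A $$ (i,i)" "0 < B $$ (i,i)"
    using inverse_nonneg[OF assms assms] by (auto simp: zero_less_mult_iff)
qed

lemma split_row_sum:
  fixes f :: "nat \<Rightarrow> real"
  assumes "i < n" "j < n" "j \<noteq> i"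
  shows "(\<Sum>k\<in>{..<n} - {j}. f k) = f i + (\<Sum>k\<in>{..<n} - {j,i}. f k)"
proof -
  have "{..<n} - {j,i} = {..<n} - {j} - {i}" by auto
  then show ?thesis using assms by (simp add: sum.remove[of _ i])
qed

lemma row_sum_less:
  assumes "j < n" shows "(\<Sum>k\<in>{..<n} - {j}. \<bar>A $$ (j,k)\<bar>) < A $$ (j,j)"
  using dominant assms diag_pos[OF assms] by (auto simp: strictly_diag_dominant_def)

lemma p_from_le_iff:
  assumes "j < n"
  shows "p_from A q j i \<le> x \<longleftrightarrow>
    \<bar>A $$ (j,i)\<bar> + (\<Sum>k\<in>{..<n} - {j,i}. \<bar>A $$ (j,k)\<bar> * q k i) \<le> A $$ (j,j) * x"
  using diag_pos[OF assms] by (simp add: p_from_def field_simps)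

lemma p_from_mono:
  assumes "offdiag_le A q q'" shows "offdiag_le A (p_from A q) (p_from A q')"
  unfolding offdiag_le_def p_from_def
  using assms by (auto simp: offdiag_le_def intro!: divide_right_mono add_left_mono sum_mono
    mult_left_mono)

lemma p_from_lower:
  assumes "supersolution A q" "i < n" "j < n" "j \<noteq> i"
  shows "\<bar>A $$ (j,i)\<bar> / A $$ (j,j) \<le> p_from A q j i"
proof -
  have "0 \<le> (\<Sum>k\<in>{..<n} - {j,i}. \<bar>A $$ (j,k)\<bar> * q k i)"
    using assms by (intro sum_nonneg) (auto simp: supersolution_def)
  then show ?thesis
    using diag_pos[OF assms(3)] by (simp add: p_from_def divide_right_mono)
qed

lemma supersolution_p_from:
  assumes "supersolution A q" shows "supersolution A (p_from A q)"
proof -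
  have "0 \<le> p_from A q j i" if ij: "i < n" "j < n" "j \<noteq> i" for i j
  proof -
    have "0 \<le> \<bar>A $$ (j,i)\<bar> / A $$ (j,j)" using diag_pos[OF ij(2)] by simp
    then show ?thesis using p_from_lower[OF assms ij] by linarith
  qed
  moreover have "offdiag_le A (p_from A (p_from A q)) (p_from A q)"
    by (intro p_from_mono offdiag_le_p_from assms)
  ultimately show ?thesis by (simp add: supersolution_def offdiag_le_def)
qed

text \<open>Comparison principle: the differences \<open>d\<^sub>k = q\<^sub>k\<^sub>i b\<^sub>i\<^sub>i - b\<^sub>k\<^sub>i\<close> satisfy
  \<open>a\<^sub>j\<^sub>j d\<^sub>j \<ge> \<Sum>\<^sub>k |a\<^sub>j\<^sub>k| d\<^sub>k\<close> with \<open>k\<close> other than \<open>j\<close> and \<open>i\<close>, and a negative minimum of \<open>d\<close> would contradict strict diagonal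
  dominance of the row where it is attained.\<close>

lemma inverse_le_supersolution:
  assumes q: "supersolution A q" and "i < n" "j < n" "j \<noteq> i"
  shows "B $$ (j,i) \<le> q j i * B $$ (i,i)"
proof -
  define d where "d k = q k i * B $$ (i,i) - B $$ (k,i)" for k
  let ?J = "{..<n} - {i}"
  have d: "(\<Sum>k\<in>{..<n} - {a,i}. \<bar>A $$ (a,k)\<bar> * d k) \<le> A $$ (a,a) * d a" if a: "a < n" "a \<noteq> i" for a
  proof -
    have "p_from A q a i \<le> q a i"
      using q a \<open>i < n\<close> by (simp add: supersolution_def)
    then have "(\<bar>A $$ (a,i)\<bar> + (\<Sum>k\<in>{..<n} - {a,i}. \<bar>A $$ (a,k)\<bar> * q k i)) * B $$ (i,i)
        \<le> A $$ (a,a) * q a i * B $$ (i,i)"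
      unfolding p_from_le_iff[OF a(1)] using diag_pos[OF \<open>i < n\<close>] by simp
    moreover have "A $$ (a,a) * B $$ (a,i)
        = \<bar>A $$ (a,i)\<bar> * B $$ (i,i) + (\<Sum>k\<in>{..<n} - {a,i}. \<bar>A $$ (a,k)\<bar> * B $$ (k,i))"
      using row_times_inverse[OF \<open>i < n\<close> a(1)] split_row_sum[OF \<open>i < n\<close> a] a(2) by simp
    ultimately show ?thesis
      by (simp add: d_def right_diff_distrib sum_subtractf distrib_right sum_distrib_right mult.assoc)
  qed
  have "?J \<noteq> {}" "finite ?J" using assms by auto
  then obtain a where a: "a \<in> ?J" and min: "\<And>k. k \<in> ?J \<Longrightarrow> d a \<le> d k"
    using Min_in[of "d ` ?J"] Min_le[of "d ` ?J"] by fastforce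
  have "0 \<le> d a"
  proof (rule ccontr)
    assume neg: "\<not> 0 \<le> d a"
    have "(\<Sum>k\<in>{..<n} - {a,i}. \<bar>A $$ (a,k)\<bar>) * d a \<le> (\<Sum>k\<in>{..<n} - {a,i}. \<bar>A $$ (a,k)\<bar> * d k)"
      unfolding sum_distrib_right using min by (intro sum_mono mult_left_mono) auto
    also have "\<dots> \<le> A $$ (a,a) * d a" using d a by simp
    finally have "A $$ (a,a) \<le> (\<Sum>k\<in>{..<n} - {a,i}. \<bar>A $$ (a,k)\<bar>)"
      using neg by simp
    also have "\<dots> \<le> (\<Sum>k\<in>{..<n} - {a}. \<bar>A $$ (a,k)\<bar>)" by (intro sum_mono2) auto
    finally show False using row_sum_less[of a] a by simp
  qed
  then have "0 \<le> d j" using min[of j] assms by simp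
  then show ?thesis by (simp add: d_def)
qed

text \<open>The last inequality says precisely that the constant \<open>r\<^sub>i\<close> is a supersolution; strict dominance
  of row \<open>j\<close> makes its bracket exceed \<open>|a\<^sub>j\<^sub>i|\<close>, whence \<open>r\<^sub>i < 1\<close>.\<close>

lemma r_coeff_bounds:
  assumes i: "i < n"
  shows "0 \<le> r_coeff A i" "r_coeff A i < 1"
    and "\<And>j. j < n \<Longrightarrow> j \<noteq> i \<Longrightarrow>
      \<bar>A $$ (j,i)\<bar> \<le> r_coeff A i * (A $$ (j,j) - (\<Sum>k\<in>{..<n} - {j,i}. \<bar>A $$ (j,k)\<bar>))"
proof -
  let ?D = "\<lambda>j. A $$ (j,j) - (\<Sum>k\<in>{..<n} - {j,i}. \<bar>A $$ (j,k)\<bar>)"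
  let ?f = "\<lambda>j. \<bar>A $$ (j,i)\<bar> / ?D j"
  have ne: "{..<n} - {i} \<noteq> {}" by (rule other_index_exists[OF n])
  have D: "\<bar>A $$ (j,i)\<bar> < ?D j" if "j < n" "j \<noteq> i" for j
    using row_sum_less[OF \<open>j < n\<close>] split_row_sum[OF i that, of "\<lambda>k. \<bar>A $$ (j,k)\<bar>"] by simp
  have r: "r_coeff A i = Max (?f ` ({..<n} - {i}))"
    unfolding r_coeff_def dim_A
    by (intro arg_cong[where f = Max] image_cong refl) (auto simp: abs_of_pos diag_pos)
  show le: "\<bar>A $$ (j,i)\<bar> \<le> r_coeff A i * ?D j" if j: "j < n" "j \<noteq> i" for j
  proof -
    have "?f j \<le> r_coeff A i" unfolding r using j by (intro Max_ge) auto
    then show ?thesis using D[OF j] by (simp add: pos_divide_le_eq)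
  qed
  have "?f j < 1" if "j < n" "j \<noteq> i" for j using D[OF that] by simp
  then show "r_coeff A i < 1" unfolding r using ne by (subst Max_less_iff) auto
  obtain j where j: "j < n" "j \<noteq> i" using ne by auto
  have "0 \<le> r_coeff A i * ?D j" using le[OF j] by linarith
  moreover have "0 < ?D j" using D[OF j] by linarith
  ultimately show "0 \<le> r_coeff A i" by (meson leD leI mult_neg_pos)
qed

lemma supersolution_r_coeff: "supersolution A (\<lambda>_. r_coeff A)"
  unfolding supersolution_def dim_A
proof (intro allI impI conjI)
  fix i j assume ij: "i < n" "j < n" "j \<noteq> i"
  show "0 \<le> r_coeff A i" by (rule r_coeff_bounds) fact
  show "p_from A (\<lambda>_. r_coeff A) j i \<le> r_coeff A i"
    unfolding p_from_le_iff[OF ij(2)] using r_coeff_bounds(3)[OF ij]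
    by (simp add: algebra_simps flip: sum_distrib_left sum_distrib_right)
qed

text \<open>The supersolution property of \<open>q\<close> says that each bracket is at least \<open>|a\<^sub>j\<^sub>i|\<close>, so \<open>h\<^sub>i \<le> 1\<close>. The
  last inequality says that the property survives multiplication by \<open>h\<^sub>i\<close>.\<close>

lemma h_from_bounds:
  assumes q: "supersolution A q" and i: "i < n"
  shows "0 \<le> h_from A q i" "h_from A q i \<le> 1"
    and "\<And>j. j < n \<Longrightarrow> j \<noteq> i \<Longrightarrow> \<bar>A $$ (j,i)\<bar>
      \<le> h_from A q i * (A $$ (j,j) * q j i - (\<Sum>k\<in>{..<n} - {j,i}. \<bar>A $$ (j,k)\<bar> * q k i))"
proof -
  let ?D = "\<lambda>j. A $$ (j,j) * q j i - (\<Sum>k\<in>{..<n} - {j,i}. \<bar>A $$ (j,k)\<bar> * q k i)"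
  let ?f = "\<lambda>j. \<bar>A $$ (j,i)\<bar> / ?D j"
  have ne: "{..<n} - {i} \<noteq> {}" by (rule other_index_exists[OF n])
  have D: "\<bar>A $$ (j,i)\<bar> \<le> ?D j" if "j < n" "j \<noteq> i" for j
    using q that i p_from_le_iff[OF \<open>j < n\<close>, of q i "q j i"] by (simp add: supersolution_def)
  have h: "h_from A q i = Max (?f ` ({..<n} - {i}))"
    unfolding h_from_def dim_A
    by (intro arg_cong[where f = Max] image_cong refl) (auto simp: abs_of_pos diag_pos)
  have f: "0 \<le> ?f j" "?f j \<le> 1" if "j < n" "j \<noteq> i" for j
    using D[OF that] by (auto simp: divide_le_eq_1 intro!: divide_nonneg_nonneg)
  have le: "?f j \<le> h_from A q i" if "j < n" "j \<noteq> i" for j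
    unfolding h using that by (intro Max_ge) auto
  show "\<bar>A $$ (j,i)\<bar> \<le> h_from A q i * ?D j" if j: "j < n" "j \<noteq> i" for j
  proof (cases "?D j = 0")
    \<comment> \<open>here \<open>a\<^sub>j\<^sub>i = 0\<close>, so the quotient \<open>0/0 = 0\<close> in the definition of \<open>h\<^sub>i\<close> is harmless\<close>
    case True
    then show ?thesis using D[OF j] by simp
  next
    case False
    then have "0 < ?D j" using D[OF j] by linarith
    then show ?thesis using le[OF j] by (simp add: pos_divide_le_eq)
  qed
  show "h_from A q i \<le> 1" unfolding h using f(2) ne by (subst Max_le_iff) auto
  obtain j where j: "j < n" "j \<noteq> i" using ne by auto
  show "0 \<le> h_from A q i" using f(1)[OF j] le[OF j] by linarith
qed

lemma rescaled_supersolution: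
  assumes q: "supersolution A q"
  shows "supersolution A (\<lambda>j i. h_from A q i * q j i)"
    and "offdiag_le A (\<lambda>j i. h_from A q i * q j i) q"
proof -
  have "0 \<le> h_from A q i * q j i" "h_from A q i * q j i \<le> q j i"
    "p_from A (\<lambda>j i. h_from A q i * q j i) j i \<le> h_from A q i * q j i"
    if ij: "i < n" "j < n" "j \<noteq> i" for i j
  proof -
    have "0 \<le> q j i" using q ij by (simp add: supersolution_def)
    then show "0 \<le> h_from A q i * q j i" "h_from A q i * q j i \<le> q j i"
      using h_from_bounds(1,2)[OF q ij(1)] by (simp_all add: mult_left_le_one_le)
    show "p_from A (\<lambda>j i. h_from A q i * q j i) j i \<le> h_from A q i * q j i"
      unfolding p_from_le_iff[OF ij(2)] using h_from_bounds(3)[OF q ij]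
      by (simp add: right_diff_distrib sum_distrib_left mult_ac)
  qed
  then show "supersolution A (\<lambda>j i. h_from A q i * q j i)"
    and "offdiag_le A (\<lambda>j i. h_from A q i * q j i) q"
    by (simp_all add: supersolution_def offdiag_le_def)
qed

lemma supersolution_u_from:
  assumes "supersolution A q" shows "supersolution A (u_from A q)" "offdiag_le A (u_from A q) q"
proof -
  note r = rescaled_supersolution[OF assms]
  show "supersolution A (u_from A q)"
    unfolding u_from_eq_p_from by (rule supersolution_p_from[OF r(1)])
  show "offdiag_le A (u_from A q) q"
    unfolding u_from_eq_p_from by (rule offdiag_le_trans[OF offdiag_le_p_from[OF r(1)] r(2)])
qed

section \<open>The iterates decrease and bound the columns of the inverse\<close>

lemma supersolution_u_seq: "supersolution A (u_seq A t)"
proof (induction t)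
  case 0
  show ?case
    by (simp add: m_coeff_eq_p_from supersolution_u_from supersolution_p_from supersolution_r_coeff)
next
  case (Suc t)
  then show ?case by (simp add: supersolution_u_from supersolution_p_from)
qed

lemma supersolution_p_seq: "supersolution A (p_seq A t)"
  by (simp add: p_seq_def supersolution_p_from supersolution_u_seq)

text \<open>For \<open>t \<ge> 1\<close> the array \<open>u\<^bsup>(t)\<^esup>\<close> lies between \<open>p\<^bsup>(t+1)\<^esup>\<close> and \<open>p\<^bsup>(t)\<^esup>\<close>. At \<open>t = 0\<close> both sides of
  the claim agree, since truncated subtraction makes \<open>p_seq A 0\<close> a copy of \<open>p_seq A 1\<close>.\<close>

lemma p_seq_Suc_le: "offdiag_le A (p_seq A (Suc t)) (p_seq A t)"
proof (cases t)
  case 0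
  then show ?thesis by (simp add: p_seq_def offdiag_le_def)
next
  case (Suc s)
  have "offdiag_le A (p_seq A (Suc t)) (u_seq A t)"
    unfolding p_seq_Suc by (intro offdiag_le_p_from supersolution_u_seq)
  moreover have "offdiag_le A (u_seq A t) (p_seq A t)"
    unfolding Suc u_seq.simps p_seq_Suc
    by (intro supersolution_u_from supersolution_p_from supersolution_u_seq)
  ultimately show ?thesis by (rule offdiag_le_trans)
qed

lemma u_seq_le_r: "offdiag_le A (u_seq A t) (\<lambda>_. r_coeff A)"
proof (induction t)
  case 0
  note m = supersolution_p_from[OF supersolution_r_coeff]
  show ?case
    unfolding u_seq.simps m_coeff_eq_p_from
    by (rule offdiag_le_trans[OF supersolution_u_from(2)[OF m]
          offdiag_le_p_from[OF supersolution_r_coeff]])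
next
  case (Suc t)
  have "offdiag_le A (u_seq A (Suc t)) (p_from A (u_seq A t))"
    unfolding u_seq.simps by (intro supersolution_u_from supersolution_p_from supersolution_u_seq)
  from offdiag_le_trans[OF this offdiag_le_p_from[OF supersolution_u_seq]] Suc
  show ?case by (rule offdiag_le_trans)
qed

context
  fixes i :: nat assumes i: "i < n"
begin

text \<open>One application of \<open>p_from A\<close> to a nonnegative array already produces this lower bound; it is
  what makes the denominator of \<open>diag_lower\<close> at least that of \<open>\<phi>\<close>, hence positive.\<close>

lemma p_seq_lower: "j < n \<Longrightarrow> j \<noteq> i \<Longrightarrow> \<bar>A $$ (j,i)\<bar> / A $$ (j,j) \<le> p_seq A t j i"
  unfolding p_seq_def by (intro p_from_lower supersolution_u_seq i)

lemma p_seq_nonneg: "j < n \<Longrightarrow> j \<noteq> i \<Longrightarrow> 0 \<le> p_seq A t j i"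
  using supersolution_p_seq i by (simp add: supersolution_def)

lemma p_seq_less_1:
  assumes "j < n" "j \<noteq> i" shows "p_seq A t j i < 1"
proof -
  have "offdiag_le A (p_seq A t) (\<lambda>_. r_coeff A)"
    unfolding p_seq_def
    by (rule offdiag_le_trans[OF offdiag_le_p_from[OF supersolution_u_seq] u_seq_le_r])
  then have "p_seq A t j i \<le> r_coeff A i" using assms i by (simp add: offdiag_le_def)
  also have "\<dots> < 1" by (rule r_coeff_bounds(2)[OF i])
  finally show ?thesis .
qed

lemma phi_denominator_pos:
  "0 < A $$ (i,i) - (\<Sum>j\<in>{..<n} - {i}. \<bar>A $$ (i,j)\<bar> * p_seq A t j i)"
proof -
  have "(\<Sum>j\<in>{..<n} - {i}. \<bar>A $$ (i,j)\<bar> * p_seq A t j i) \<le> (\<Sum>j\<in>{..<n} - {i}. \<bar>A $$ (i,j)\<bar>)"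
    using p_seq_less_1 by (intro sum_mono mult_right_le_one_le) (auto simp: less_imp_le p_seq_nonneg)
  then show ?thesis using row_sum_less[OF i] by simp
qed

lemma phi_pos: "0 < phi A t i"
  using phi_denominator_pos by (simp add: phi_def)

lemma p_sum_nonneg: "0 \<le> p_sum A t i"
  unfolding p_sum_def by (intro sum_nonneg) (auto simp: p_seq_nonneg)

lemma offdiag_column_sum_le: "(\<Sum>k\<in>{..<n} - {i}. B $$ (k,i)) \<le> p_sum A t i * B $$ (i,i)"
  unfolding p_sum_def dim_A sum_distrib_right
  using i by (intro sum_mono inverse_le_supersolution supersolution_p_seq) auto

text \<open>Row \<open>i\<close> of \<open>A B = I\<close> reads \<open>a\<^sub>i\<^sub>i b\<^sub>i\<^sub>i - \<Sum>\<^sub>j |a\<^sub>i\<^sub>j| b\<^sub>j\<^sub>i = 1\<close>; replacing \<open>b\<^sub>j\<^sub>i\<close> by its upper bound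
  \<open>p\<^sub>j\<^sub>i b\<^sub>i\<^sub>i\<close> leaves at most 1.\<close>

lemma inverse_diag_le_phi: "B $$ (i,i) \<le> phi A t i"
proof -
  have "(\<Sum>j\<in>{..<n} - {i}. \<bar>A $$ (i,j)\<bar> * B $$ (j,i))
      \<le> (\<Sum>j\<in>{..<n} - {i}. \<bar>A $$ (i,j)\<bar> * (p_seq A t j i * B $$ (i,i)))"
    using i by (intro sum_mono mult_left_mono inverse_le_supersolution supersolution_p_seq) auto
  also have "\<dots> = (\<Sum>j\<in>{..<n} - {i}. \<bar>A $$ (i,j)\<bar> * p_seq A t j i) * B $$ (i,i)"
    by (simp add: sum_distrib_right mult.assoc)
  finally have "B $$ (i,i) * (A $$ (i,i) - (\<Sum>j\<in>{..<n} - {i}. \<bar>A $$ (i,j)\<bar> * p_seq A t j i)) \<le> 1"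
    using row_times_inverse[OF i i] by (simp add: algebra_simps)
  then show ?thesis
    using phi_denominator_pos by (simp add: phi_def pos_le_divide_eq)
qed

text \<open>Dropping the nonnegative sum from the equation of row \<open>j\<close> gives
  \<open>b\<^sub>j\<^sub>i \<ge> |a\<^sub>j\<^sub>i| b\<^sub>i\<^sub>i / a\<^sub>j\<^sub>j\<close>, which is then inserted into row \<open>i\<close> of \<open>A B = I\<close>.\<close>

lemma diag_lower_le_inverse_diag: "diag_lower A i \<le> B $$ (i,i)"
proof -
  let ?x = "\<lambda>j. \<bar>A $$ (j,i)\<bar> / A $$ (j,j)"
  let ?S = "\<Sum>j\<in>{..<n} - {i}. \<bar>A $$ (i,j)\<bar> * ?x j"
  have S: "(\<Sum>k\<in>{..<n} - {i}. A $$ (i,k) * A $$ (k,i) / A $$ (k,k)) = ?S"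
    using i by (intro sum.cong refl) (subst (1 2) offdiag_abs, auto)
  have "?S \<le> (\<Sum>j\<in>{..<n} - {i}. \<bar>A $$ (i,j)\<bar> * p_seq A 1 j i)"
    by (intro sum_mono mult_left_mono p_seq_lower) auto
  then have pos: "0 < A $$ (i,i) - ?S" using phi_denominator_pos[of 1] by linarith
  have x: "?x j * B $$ (i,i) \<le> B $$ (j,i)" if j: "j < n" "j \<noteq> i" for j
  proof -
    have "0 \<le> (\<Sum>k\<in>{..<n} - {j,i}. \<bar>A $$ (j,k)\<bar> * B $$ (k,i))"
      using i by (intro sum_nonneg) (auto simp: inverse_nonneg)
    then have "\<bar>A $$ (j,i)\<bar> * B $$ (i,i) \<le> A $$ (j,j) * B $$ (j,i)"
      using row_times_inverse[OF i j(1)] split_row_sum[OF i j] j by simp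
    then show ?thesis using diag_pos[OF j(1)] by (simp add: field_simps)
  qed
  have "?S * B $$ (i,i) = (\<Sum>j\<in>{..<n} - {i}. \<bar>A $$ (i,j)\<bar> * (?x j * B $$ (i,i)))"
    by (simp only: sum_distrib_right mult.assoc)
  also have "\<dots> \<le> (\<Sum>j\<in>{..<n} - {i}. \<bar>A $$ (i,j)\<bar> * B $$ (j,i))"
    by (intro sum_mono mult_left_mono x) auto
  finally have "1 \<le> B $$ (i,i) * (A $$ (i,i) - ?S)"
    using row_times_inverse[OF i i] by (simp add: algebra_simps)
  then show ?thesis
    using pos by (simp add: diag_lower_def S pos_divide_le_eq)
qed

lemma p_sum_Suc_le: "p_sum A (Suc t) i \<le> p_sum A t i"
  unfolding p_sum_def using p_seq_Suc_le i by (intro sum_mono) (auto simp: offdiag_le_def)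

lemma phi_Suc_le: "phi A (Suc t) i \<le> phi A t i"
proof -
  have "(\<Sum>j\<in>{..<n} - {i}. \<bar>A $$ (i,j)\<bar> * p_seq A (Suc t) j i)
      \<le> (\<Sum>j\<in>{..<n} - {i}. \<bar>A $$ (i,j)\<bar> * p_seq A t j i)"
    using p_seq_Suc_le i
    by (intro sum_mono mult_left_mono) (auto simp: offdiag_le_def)
  then show ?thesis
    unfolding phi_def dim_A using phi_denominator_pos by (intro divide_left_mono) (auto intro: mult_pos_pos)
qed

end

section \<open>The two bounds on the minimum eigenvalue\<close>

text \<open>Needed because \<open>tau\<close> is a reciprocal: the upper bounds for the spectral radius can be inverted
  only if it is nonzero. Since \<open>B\<close> is invertible, 0 is not one of its eigenvalues.\<close>

lemma spectral_radius_pos: "0 < spectral_radius (map_mat complex_of_real B)"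
proof -
  let ?C = "map_mat complex_of_real B"
  have C: "?C \<in> carrier_mat n n" using inverse_carrier by simp
  obtain l v where l: "spectral_radius ?C = norm l" and v: "v \<in> carrier_vec n" "v \<noteq> 0\<^sub>v n"
    and Cv: "?C *\<^sub>v v = l \<cdot>\<^sub>v v"
    using spectral_radius_mem_max(1)[OF C] n C
    by (auto simp: spectrum_def eigenvalue_def eigenvector_def)
  let ?A = "map_mat complex_of_real A"
  have A: "?A \<in> carrier_mat n n" using A_carrier by simp
  have "?A * ?C = map_mat complex_of_real (A * B)"
    by (rule of_real_hom.mat_hom_mult[symmetric, OF A_carrier inverse_carrier])
  then have "?A * ?C = 1\<^sub>m n" by (simp add: mult_inverse of_real_hom.mat_hom_one)
  then have "v = ?A *\<^sub>v (l \<cdot>\<^sub>v v)"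
    using assoc_mult_mat_vec[OF A C v(1)] v(1) by (simp add: Cv)
  then have eq: "v = l \<cdot>\<^sub>v (?A *\<^sub>v v)" using mult_mat_vec[OF A v(1)] by simp
  have "l \<noteq> 0"
  proof
    assume "l = 0"
    then have "v = 0\<^sub>v n" using A by (subst eq) (auto intro!: eq_vecI)
    with v(2) show False by simp
  qed
  then show ?thesis using l by simp
qed

definition "Gamma_term t i j = phi A t i + phi A t j
  + sqrt ((phi2 A t i j)\<^sup>2 + 4 * phi A t i * phi A t j * p_sum A t i * p_sum A t j)"

abbreviation "index_pairs \<equiv> {(i,j). i < n \<and> j < n \<and> i \<noteq> j}"

lemma Gamma_seq_eq: "Gamma_seq A t = 2 / Max ((\<lambda>(i,j). Gamma_term t i j) ` index_pairs)"
  unfolding Gamma_seq_def Gamma_term_def dim_A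
  by (rule arg_cong[where f = "\<lambda>S. 2 / Max S"]) auto

lemma index_pairs: "finite index_pairs" "index_pairs \<noteq> {}"
proof -
  have "index_pairs \<subseteq> {..<n} \<times> {..<n}" by auto
  then show "finite index_pairs" by (rule finite_subset) simp
  have "(0,1) \<in> index_pairs" using n by auto
  then show "index_pairs \<noteq> {}" by blast
qed

text \<open>Both \<open>b\<^sub>i\<^sub>i\<close> and \<open>b\<^sub>j\<^sub>j\<close> lie between the smaller value of \<open>diag_lower\<close> and the larger value of \<open>\<phi>\<close>,
  whose distance is \<open>phi2\<close>. In particular \<open>phi2\<close> is nonnegative, so that its square decreases with it.\<close>

lemma phi2_bounds:
  assumes "i < n" "j < n"
  shows "\<bar>B $$ (i,i) - B $$ (j,j)\<bar> \<le> phi2 A t i j" "phi2 A (Suc t) i j \<le> phi2 A t i j"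
  using inverse_diag_le_phi[of i t] inverse_diag_le_phi[of j t] assms
    diag_lower_le_inverse_diag[of i] diag_lower_le_inverse_diag[of j]
    phi_Suc_le[of i t] phi_Suc_le[of j t]
  by (auto simp: phi2_def)

lemma Gamma_term_pos:
  assumes "i < n" "j < n" shows "0 < Gamma_term t i j"
proof -
  have "0 \<le> 4 * phi A t i * phi A t j * p_sum A t i * p_sum A t j"
    using assms phi_pos[of i t] phi_pos[of j t] p_sum_nonneg[of i t] p_sum_nonneg[of j t] by simp
  then have "0 \<le> sqrt ((phi2 A t i j)\<^sup>2 + 4 * phi A t i * phi A t j * p_sum A t i * p_sum A t j)"
    by simp
  then show ?thesis using phi_pos[OF assms(1), of t] phi_pos[OF assms(2), of t]
    by (simp add: Gamma_term_def add_pos_nonneg)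
qed

lemma Gamma_term_Suc_le:
  assumes ij: "i < n" "j < n"
  shows "Gamma_term (Suc t) i j \<le> Gamma_term t i j"
proof -
  have "(phi2 A (Suc t) i j)\<^sup>2 \<le> (phi2 A t i j)\<^sup>2"
    using phi2_bounds[OF ij] abs_ge_zero by (intro power_mono) (blast intro: order_trans)+
  moreover have "4 * phi A (Suc t) i * phi A (Suc t) j * p_sum A (Suc t) i * p_sum A (Suc t) j
      \<le> 4 * phi A t i * phi A t j * p_sum A t i * p_sum A t j"
    using ij
    by (intro mult_mono phi_Suc_le p_sum_Suc_le mult_nonneg_nonneg less_imp_le[OF phi_pos]
        p_sum_nonneg) auto
  ultimately show ?thesis
    unfolding Gamma_term_def using phi_Suc_le[OF ij(1)] phi_Suc_le[OF ij(2)]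
    by (intro add_mono real_sqrt_le_mono)
qed

lemma spectral_radius_le_Gamma_term:
  obtains i j where "i < n" "j < n" "i \<noteq> j"
    "2 * spectral_radius (map_mat complex_of_real B) \<le> Gamma_term t i j"
proof -
  let ?c = "\<lambda>i. \<Sum>k\<in>{..<n} - {i}. B $$ (k,i)"
  obtain i j where ij: "i < n" "j < n" "i \<noteq> j" and le:
    "2 * spectral_radius (map_mat complex_of_real B) \<le> B $$ (i,i) + B $$ (j,j)
      + sqrt ((B $$ (i,i) - B $$ (j,j))\<^sup>2 + 4 * (?c i * ?c j))"
    using spectral_radius_le_Brauer[OF inverse_carrier n inverse_nonneg] by metis
  have c: "0 \<le> ?c a" "?c a \<le> phi A t a * p_sum A t a" if "a < n" for a
  proof -
    show "0 \<le> ?c a" using that by (intro sum_nonneg) (auto simp: inverse_nonneg)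
    have "p_sum A t a * B $$ (a,a) \<le> p_sum A t a * phi A t a"
      using that by (intro mult_left_mono inverse_diag_le_phi p_sum_nonneg)
    then show "?c a \<le> phi A t a * p_sum A t a"
      using offdiag_column_sum_le[OF that, of t] by (simp add: mult.commute)
  qed
  have "(B $$ (i,i) - B $$ (j,j))\<^sup>2 \<le> (phi2 A t i j)\<^sup>2"
    using power_mono[OF phi2_bounds(1)[OF ij(1,2)] abs_ge_zero, of 2] by simp
  moreover have "4 * (?c i * ?c j) \<le> 4 * phi A t i * phi A t j * p_sum A t i * p_sum A t j"
    using mult_mono[OF c(2)[OF ij(1)] c(2)[OF ij(2)]] c(1) ij
      phi_pos[OF ij(1), of t] p_sum_nonneg[OF ij(1), of t] by (simp add: mult_ac)
  ultimately have "B $$ (i,i) + B $$ (j,j)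
      + sqrt ((B $$ (i,i) - B $$ (j,j))\<^sup>2 + 4 * (?c i * ?c j)) \<le> Gamma_term t i j"
    unfolding Gamma_term_def using ij
    by (intro add_mono real_sqrt_le_mono inverse_diag_le_phi)
  then show thesis using that[OF ij] le by simp
qed

lemma Gamma_seq_Suc_ge: "Gamma_seq A t \<le> Gamma_seq A (Suc t)"
proof -
  have "1 / Max ((\<lambda>(i,j). Gamma_term t i j) ` index_pairs)
      \<le> 1 / Max ((\<lambda>(i,j). Gamma_term (Suc t) i j) ` index_pairs)"
    by (rule inverse_Max_mono[OF index_pairs]) (auto intro: Gamma_term_Suc_le Gamma_term_pos)
  then show ?thesis by (simp add: Gamma_seq_eq divide_right_mono)
qed

lemma Gamma_seq_le_tau: "Gamma_seq A t \<le> tau A"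
proof -
  obtain i j where ij: "i < n" "j < n" "i \<noteq> j"
    "2 * spectral_radius (map_mat complex_of_real B) \<le> Gamma_term t i j"
    by (rule spectral_radius_le_Gamma_term)
  have "1 / Max ((\<lambda>(i,j). Gamma_term t i j) ` index_pairs)
      \<le> 1 / (2 * spectral_radius (map_mat complex_of_real B))"
    using ij spectral_radius_pos index_pairs by (intro inverse_Max_le[where a = "(i,j)"]) auto
  then show ?thesis by (simp add: Gamma_seq_eq tau_def inverse_eq_divide)
qed

lemma Omega_seq_Suc_ge: "Omega_seq A t \<le> Omega_seq A (Suc t)"
  unfolding Omega_seq_def dim_A
proof (rule inverse_Max_mono)
  show "{..<n} \<noteq> {}" using n by (auto simp: lessThan_empty_iff)
  fix i assume "i \<in> {..<n}"
  then have i: "i < n" by simp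
  show "(1 + p_sum A (Suc t) i) * phi A (Suc t) i \<le> (1 + p_sum A t i) * phi A t i"
    using p_sum_Suc_le[OF i] phi_Suc_le[OF i] phi_pos[OF i] p_sum_nonneg[OF i]
    by (intro mult_mono) (auto simp: less_imp_le)
  show "0 < (1 + p_sum A (Suc t) i) * phi A (Suc t) i"
    using phi_pos[OF i] p_sum_nonneg[OF i] by (intro mult_pos_pos add_pos_nonneg) auto
qed simp

lemma Omega_seq_le_tau: "Omega_seq A t \<le> tau A"
proof -
  obtain i where i: "i < n"
    and le: "spectral_radius (map_mat complex_of_real B) \<le> (\<Sum>k<n. B $$ (k,i))"
    using spectral_radius_le_column_sum[OF inverse_carrier n inverse_nonneg] by metis
  note le
  also have "(\<Sum>k<n. B $$ (k,i)) = B $$ (i,i) + (\<Sum>k\<in>{..<n} - {i}. B $$ (k,i))"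
    using i by (simp add: sum.remove[of _ i])
  also have "\<dots> \<le> (1 + p_sum A t i) * B $$ (i,i)"
    using offdiag_column_sum_le[OF i, of t] by (simp add: algebra_simps)
  also have "\<dots> \<le> (1 + p_sum A t i) * phi A t i"
    using inverse_diag_le_phi[OF i] p_sum_nonneg[OF i] by (intro mult_left_mono) auto
  finally show ?thesis
    unfolding Omega_seq_def dim_A tau_def inverse_eq_divide
    using i spectral_radius_pos by (intro inverse_Max_le[where a = i]) auto
qed

end

theorem theorem7:
  fixes A :: "real mat" and n :: nat
  assumes "n \<ge> 2"
    and "A \<in> M_matrices n"
    and "strictly_diag_dominant A"
  shows "mono_on {1..} (Gamma_seq A) \<and> (\<forall>t\<ge>1. Gamma_seq A t \<le> tau A) \<and> convergent (Gamma_seq A) \<and>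
         mono_on {1..} (Omega_seq A) \<and> (\<forall>t\<ge>1. Omega_seq A t \<le> tau A) \<and> convergent (Omega_seq A)"
proof -
  interpret diag_dominant_M_matrix A n by unfold_locales fact+
  show ?thesis
    using increasing_bounded_convergent[of "Gamma_seq A", OF Gamma_seq_Suc_ge Gamma_seq_le_tau]
      increasing_bounded_convergent[of "Omega_seq A", OF Omega_seq_Suc_ge Omega_seq_le_tau]
      Gamma_seq_le_tau Omega_seq_le_tau
    by simp
qed

end
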